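(* Let $P$ be a poset such that for every $x,y\in P$ the set of minimal elements of $\{z\in P: x\le z,\ y\le z\}$ has at most one element, such that $P$ has a minimum element $\hat 0$, $P$ is ranked with rank function $\rho$, and $\rho(x\vee y)\le\rho(x)+\rho(y)$ for all $x,y\in P$ for which $x\vee y$ exists. Let $\tilde P$ be the small category defined below, and let $\ell\colon\operatorname{Mor}(\tilde P)\to P$ be given by $\ell(f^d_{x,y})=d$. Then $(\tilde P,P,\ell)$ is a schemoid.
   Context: For $x,y\in P$, if $\{z: x\le z,\ y\le z\}\neq\emptyset$ then $x\vee y$ denotes its unique minimal (hence minimum) element. The category $\tilde P$ has object set $P$; for each triple $x,y,d\in P$ with $y=x\vee d$ and $\rho(y)=\rho(x)+\rho(d)$ there is a morphism $f^d_{x,y}$ from $x$ to $y$ (distinct triples giving distinct morphisms), and these are all the morphisms, i.e. $\operatorname{Hom}_{\tilde P}(x,y)=\{f^d_{x,y}: d\in P,\ y=x\vee d,\ \rho(y)=\rho(x)+\rho(d)\}$. Composition is $f^d_{y,z}\circ f^c_{x,y}=f^{d\vee c}_{x,z}$. A schemoid: for a small category $\mathcal{C}$, a set $I$ and a map $\ell\colon\operatorname{Mor}(\mathcal{C})\to I$, let $N^{i,j}_h=\{(f,g): \ell(f)=i,\ \ell(g)=j,\ f\circ g=h\}$ for $i,j\in I$, $h\in\operatorname{Mor}(\mathcal{C})$; $(\mathcal{C},I,\ell)$ is a schemoid if $\ell(h)=\ell(k)$ implies $|N^{i,j}_h|=|N^{i,j}_k|$ for all $i,j\in I$. *)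

theory Defs
  imports Main "HOL-Library.FuncSet" "HOL-Library.Equipollence"
begin

section \<open>Joins and rank functions\<close>

text \<open>The poset \<open>P\<close> is a type of class \<open>order_bot\<close>, with \<open>bot\<close> as its minimum element.\<close>

definition upper_bounds :: "'a::order \<Rightarrow> 'a \<Rightarrow> 'a set" where
  "upper_bounds x y = {z. x \<le> z \<and> y \<le> z}"

definition minimal_upper_bounds :: "'a::order \<Rightarrow> 'a \<Rightarrow> 'a set" where
  "minimal_upper_bounds x y =
     {z \<in> upper_bounds x y. \<forall>w \<in> upper_bounds x y. \<not> w < z}"

text \<open>\<open>join x y\<close> is only meaningful when \<open>has_join x y\<close> holds.\<close>

definition has_join :: "'a::order \<Rightarrow> 'a \<Rightarrow> bool" where
  "has_join x y \<longleftrightarrow> upper_bounds x y \<noteq> {}"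

definition join :: "'a::order \<Rightarrow> 'a \<Rightarrow> 'a" where
  "join x y = (THE z. z \<in> minimal_upper_bounds x y)"

definition is_covered_by :: "'a::order \<Rightarrow> 'a \<Rightarrow> bool" where
  "is_covered_by x y \<longleftrightarrow> x < y \<and> (\<nexists>z. x < z \<and> z < y)"

text \<open>Strict monotonicity is not redundant: in an infinite poset the covering condition alone
  may be vacuous. Together the three conditions say that for every \<open>x\<close> all maximal chains
  from \<open>bot\<close> to \<open>x\<close> have the same finite length \<open>\<rho> x\<close>.\<close>

definition rank_function :: "('a::order_bot \<Rightarrow> nat) \<Rightarrow> bool" where
  "rank_function \<rho> \<longleftrightarrow> \<rho> bot = 0 \<and> strict_mono \<rho> \<and>
     (\<forall>x y. is_covered_by x y \<longrightarrow> \<rho> y = \<rho> x + 1)"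

section \<open>Small categories and schemoids\<close>

record ('o, 'm) cat =
  Obj :: "'o set"
  Mor :: "'m set"
  Dom :: "'m \<Rightarrow> 'o"
  Cod :: "'m \<Rightarrow> 'o"
  Comp :: "'m \<Rightarrow> 'm \<Rightarrow> 'm"

text \<open>\<open>Comp C f g\<close> is \<open>f \<circ> g\<close> (first \<open>g\<close>, then \<open>f\<close>); its value is irrelevant
  unless \<open>Dom C f = Cod C g\<close>. Identities are determined by the composition, hence not
  part of the record.\<close>

definition small_category :: "('o, 'm) cat \<Rightarrow> bool" where
  "small_category C \<longleftrightarrow>
     Dom C \<in> Mor C \<rightarrow> Obj C \<and> Cod C \<in> Mor C \<rightarrow> Obj C \<and>
     (\<forall>f \<in> Mor C. \<forall>g \<in> Mor C. Dom C f = Cod C g \<longrightarrow>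
        Comp C f g \<in> Mor C \<and> Dom C (Comp C f g) = Dom C g \<and> Cod C (Comp C f g) = Cod C f) \<and>
     (\<forall>f \<in> Mor C. \<forall>g \<in> Mor C. \<forall>h \<in> Mor C. Dom C f = Cod C g \<longrightarrow> Dom C g = Cod C h \<longrightarrow>
        Comp C (Comp C f g) h = Comp C f (Comp C g h)) \<and>
     (\<forall>x \<in> Obj C. \<exists>e \<in> Mor C. Dom C e = x \<and> Cod C e = x \<and>
        (\<forall>f \<in> Mor C. Dom C f = x \<longrightarrow> Comp C f e = f) \<and>
        (\<forall>g \<in> Mor C. Cod C g = x \<longrightarrow> Comp C e g = g))"

definition factorizations ::
    "('o, 'm) cat \<Rightarrow> ('m \<Rightarrow> 'i) \<Rightarrow> 'i \<Rightarrow> 'i \<Rightarrow> 'm \<Rightarrow> ('m \<times> 'm) set" where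
  "factorizations C l i j h =
     {(f, g). f \<in> Mor C \<and> g \<in> Mor C \<and> Dom C f = Cod C g \<and>
              l f = i \<and> l g = j \<and> Comp C f g = h}"

text \<open>Cardinalities are compared by equipollence, since \<open>card\<close> sends every infinite set to 0.\<close>

definition schemoid :: "('o, 'm) cat \<Rightarrow> 'i set \<Rightarrow> ('m \<Rightarrow> 'i) \<Rightarrow> bool" where
  "schemoid C I l \<longleftrightarrow> small_category C \<and> l \<in> Mor C \<rightarrow> I \<and>
     (\<forall>h \<in> Mor C. \<forall>k \<in> Mor C. l h = l k \<longrightarrow>
        (\<forall>i \<in> I. \<forall>j \<in> I. factorizations C l i j h \<approx> factorizations C l i j k))"

section \<open>The category of a ranked poset\<close>

text \<open>\<open>Arrow x y d\<close> stands for \<open>f\<^sup>d\<close> from \<open>x\<close> to \<open>y\<close>.\<close>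

datatype 'a arrow = Arrow (source: 'a) (target: 'a) (label: 'a)

definition poset_cat :: "('a::order \<Rightarrow> nat) \<Rightarrow> ('a, 'a arrow) cat" where
  "poset_cat \<rho> =
     \<lparr>Obj = UNIV,
      Mor = {Arrow x y d | x y d. has_join x d \<and> y = join x d \<and> \<rho> y = \<rho> x + \<rho> d},
      Dom = source,
      Cod = target,
      Comp = (\<lambda>f g. Arrow (source g) (target f) (join (label f) (label g)))\<rparr>"

end

theory Submission
  imports Defs
begin

text \<open>If \<open>x \<rightarrow> x \<or> c \<rightarrow> (x \<or> c) \<or> d\<close> are composable morphisms labelled \<open>c\<close> and \<open>d\<close>, then
  \<open>\<rho> x + \<rho> c + \<rho> d = \<rho> (x \<or> c \<or> d) \<le> \<rho> x + \<rho> (c \<or> d) \<le> \<rho> x + \<rho> c + \<rho> d\<close>, so all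
  inequalities are equalities and the composite is a morphism. The same squeeze, run with the
  other bracketing, shows that a morphism labelled \<open>e\<close> has exactly one factorization with labels
  \<open>i, j\<close> if \<open>e = i \<or> j\<close> and \<open>\<rho> e = \<rho> i + \<rho> j\<close>, and none otherwise. This condition does not
  mention the source of the morphism.\<close>

text \<open>A relation carries existence along with the value, whereas \<open>join\<close> is a
  description that is meaningful only under \<open>has_join\<close>.\<close>

definition is_join :: "'a::order \<Rightarrow> 'a \<Rightarrow> 'a \<Rightarrow> bool" where
  "is_join x y z \<longleftrightarrow> x \<le> z \<and> y \<le> z \<and> (\<forall>w. x \<le> w \<longrightarrow> y \<le> w \<longrightarrow> z \<le> w)"

lemma is_join_upper: "is_join x y z \<Longrightarrow> x \<le> z" "is_join x y z \<Longrightarrow> y \<le> z"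
  and is_join_least: "is_join x y z \<Longrightarrow> x \<le> w \<Longrightarrow> y \<le> w \<Longrightarrow> z \<le> w"
  by (auto simp: is_join_def)

lemma is_join_unique: "is_join x y z \<Longrightarrow> is_join x y z' \<Longrightarrow> z = z'"
  by (auto simp: is_join_def intro: order.antisym)

lemma is_join_commute: "is_join x y z \<longleftrightarrow> is_join y x z"
  by (auto simp: is_join_def)

text \<open>Both sides say that \<open>z\<close> is the least upper bound of \<open>x\<close>,
  \<open>c\<close> and \<open>d\<close>. No existence claim is involved beyond the two inner
  joins.\<close>

lemma is_join_assoc:
  assumes "is_join x c y" "is_join c d e"
  shows "is_join y d z \<longleftrightarrow> is_join x e z"
  using assms unfolding is_join_def by (meson order.trans)

lemma join_eqI:
  assumes "is_join x y z"
  shows "join x y = z"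
  unfolding join_def
  using assms
  by (intro the_equality)
    (auto simp: is_join_def minimal_upper_bounds_def upper_bounds_def less_le_not_le
      intro: order.antisym)

lemma has_joinI: "is_join x y z \<Longrightarrow> has_join x y"
  by (auto simp: is_join_def has_join_def upper_bounds_def)

locale subadditive_rank =
  fixes \<rho> :: "'a::order_bot \<Rightarrow> nat"
  assumes unique: "\<And>x y :: 'a. \<exists>\<^sub>\<le>\<^sub>1 z. z \<in> minimal_upper_bounds x y"
    and rank: "rank_function \<rho>"
    and subadditive: "has_join x y \<Longrightarrow> \<rho> (join x y) \<le> \<rho> x + \<rho> y"
begin

lemma rank_bot: "\<rho> bot = 0"
  using rank by (simp add: rank_function_def)

lemma rank_less: "x < y \<Longrightarrow> \<rho> x < \<rho> y"
  using rank by (simp add: rank_function_def strict_mono_def)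

text \<open>Descent on the rank: strict monotonicity into the naturals rules out infinite descending
  chains.\<close>

lemma minimal_upper_bound_below:
  fixes w x y :: 'a
  assumes "w \<in> upper_bounds x y"
  shows "\<exists>z\<le>w. z \<in> minimal_upper_bounds x y"
  using assms
proof (induction "\<rho> w" arbitrary: w rule: less_induct)
  case less
  show ?case
  proof (cases "w \<in> minimal_upper_bounds x y")
    case False
    then obtain v where "v \<in> upper_bounds x y" "v < w"
      using less.prems by (auto simp: minimal_upper_bounds_def)
    then show ?thesis
      using less.hyps rank_less by (meson order.strict_implies_order order.trans)
  qed auto
qed

lemma is_join_exists:
  fixes w x y :: 'a
  assumes "x \<le> w" "y \<le> w"
  obtains z where "is_join x y z"
proof -
  have "w \<in> upper_bounds x y"
    using assms by (simp add: upper_bounds_def)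
  then obtain z where z: "z \<in> minimal_upper_bounds x y"
    using minimal_upper_bound_below by blast
  \<comment> \<open>Minimal becomes minimum: \<open>v\<close> lies above some minimal upper bound,
    and by uniqueness that one is \<open>z\<close>.\<close>
  have "z \<le> v" if "x \<le> v" "y \<le> v" for v
  proof -
    have "v \<in> upper_bounds x y"
      using that by (simp add: upper_bounds_def)
    then obtain z' where "z' \<le> v" "z' \<in> minimal_upper_bounds x y"
      using minimal_upper_bound_below by blast
    with z unique show "z \<le> v"
      by (metis Uniq_D)
  qed
  with z have "is_join x y z"
    by (simp add: is_join_def minimal_upper_bounds_def upper_bounds_def)
  then show thesis ..
qed

lemma has_join_and_eq_iff:
  fixes x y z :: 'a
  shows "has_join x y \<and> z = join x y \<longleftrightarrow> is_join x y z"
proof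
  assume a: "has_join x y \<and> z = join x y"
  then obtain w where "x \<le> w" "y \<le> w"
    by (auto simp: has_join_def upper_bounds_def)
  then obtain v where "is_join x y v"
    by (rule is_join_exists)
  with a show "is_join x y z"
    by (simp add: join_eqI)
qed (auto dest: join_eqI has_joinI)

lemma rank_is_join_le: "is_join x y z \<Longrightarrow> \<rho> z \<le> \<rho> x + \<rho> y"
  using subadditive has_join_and_eq_iff by metis

lemma Arrow_mem_Mor_iff:
  "Arrow x y d \<in> Mor (poset_cat \<rho>) \<longleftrightarrow> is_join x d y \<and> \<rho> y = \<rho> x + \<rho> d"
  using has_join_and_eq_iff[of x d y] by (auto simp: poset_cat_def)

lemma poset_cat_sel [simp]:
  "Obj (poset_cat \<rho>) = UNIV" "Dom (poset_cat \<rho>) = source" "Cod (poset_cat \<rho>) = target"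
  "Comp (poset_cat \<rho>) f g = Arrow (source g) (target f) (join (label f) (label g))"
  by (simp_all add: poset_cat_def)

lemma composable:
  assumes g: "Arrow x y c \<in> Mor (poset_cat \<rho>)" and f: "Arrow y z d \<in> Mor (poset_cat \<rho>)"
  shows "is_join d c (join d c)" "\<rho> (join d c) = \<rho> d + \<rho> c"
    and "Arrow x z (join d c) \<in> Mor (poset_cat \<rho>)"
proof -
  from g f have gj: "is_join x c y" "\<rho> y = \<rho> x + \<rho> c" and fj: "is_join y d z" "\<rho> z = \<rho> y + \<rho> d"
    by (simp_all add: Arrow_mem_Mor_iff)
  \<comment> \<open>The target \<open>z\<close> is a common upper bound of the labels, so their join
    exists.\<close>
  have "d \<le> z" "c \<le> z"
    using gj fj is_join_upper by (blast intro: order.trans)+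
  then obtain e where e: "is_join d c e"
    by (rule is_join_exists)
  then have [simp]: "join d c = e"
    by (rule join_eqI)
  have z: "is_join x e z"
    using is_join_assoc[of x c y d e z] gj fj e by (simp add: is_join_commute)
  have "\<rho> z \<le> \<rho> x + \<rho> e" "\<rho> e \<le> \<rho> d + \<rho> c"
    using rank_is_join_le z e by auto
  \<comment> \<open>Since \<rho> z = \<rho> x + \<rho> c + \<rho> d, neither of the two inequalities
    can be strict.\<close>
  then have "\<rho> e = \<rho> d + \<rho> c"
    using gj fj by simp
  then show "is_join d c (join d c)" "\<rho> (join d c) = \<rho> d + \<rho> c"
    and "Arrow x z (join d c) \<in> Mor (poset_cat \<rho>)"
    using e z gj fj by (simp_all add: Arrow_mem_Mor_iff)
qed

text \<open>The right factor starts at \<open>x\<close> with label \<open>j\<close>, which forces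
  the middle object to be \<open>join x j\<close>; so at most one pair is possible.\<close>

lemma factorizations_Arrow:
  assumes h: "Arrow x z e \<in> Mor (poset_cat \<rho>)"
  shows "factorizations (poset_cat \<rho>) label i j (Arrow x z e) =
    (if is_join i j e \<and> \<rho> e = \<rho> i + \<rho> j
     then {(Arrow (join x j) z i, Arrow x (join x j) j)} else {})"
    (is "?F = (if ?c then {?p} else {})")
proof -
  have sub: "?c \<and> p = ?p" if p: "p \<in> ?F" for p
  proof -
    obtain y where y: "p = (Arrow y z i, Arrow x y j)" "join i j = e"
      and m: "Arrow x y j \<in> Mor (poset_cat \<rho>)" "Arrow y z i \<in> Mor (poset_cat \<rho>)"
    proof -
      obtain f g where "p = (f, g)" "f \<in> Mor (poset_cat \<rho>)" "g \<in> Mor (poset_cat \<rho>)"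
        "source f = target g" "label f = i" "label g = j" "source g = x" "target f = z"
        "join i j = e"
        using p by (auto simp: factorizations_def)
      then show thesis
        using that[of "target g"] by (metis arrow.collapse)
    qed
    moreover have "join x j = y"
      using m by (simp add: Arrow_mem_Mor_iff join_eqI)
    ultimately show ?thesis
      using composable[OF m] by simp
  qed
  have "?p \<in> ?F" if c: ?c
  proof -
    have z: "is_join x e z" "\<rho> z = \<rho> x + \<rho> e"
      using h by (simp_all add: Arrow_mem_Mor_iff)
    \<comment> \<open>Here \<open>j\<close> lies below \<open>e\<close>, which lies below
      \<open>z\<close>; hence the middle object exists.\<close>
    have "x \<le> z" "j \<le> z"
      using z c is_join_upper by (blast intro: order.trans)+
    then obtain y where y: "is_join x j y"
      by (rule is_join_exists)
    then have [simp]: "join x j = y"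
      by (rule join_eqI)
    have yz: "is_join y i z"
      using is_join_assoc[of x j y i e z] y z c by (simp add: is_join_commute)
    have "\<rho> y \<le> \<rho> x + \<rho> j" "\<rho> z \<le> \<rho> y + \<rho> i"
      using rank_is_join_le y yz by auto
    \<comment> \<open>The outer terms agree, as \<rho> z = \<rho> x + \<rho> i + \<rho> j, so both
      bounds are attained.\<close>
    then have "\<rho> y = \<rho> x + \<rho> j" "\<rho> z = \<rho> y + \<rho> i"
      using z c by auto
    then show ?thesis
      using y yz c by (simp add: factorizations_def Arrow_mem_Mor_iff join_eqI)
  qed
  with sub show ?thesis
    by auto
qed

lemma small_category_poset_cat: "small_category (poset_cat \<rho>)"
proof -
  let ?C = "poset_cat \<rho>"
  have comp: "Comp ?C f g \<in> Mor ?C"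
    if "f \<in> Mor ?C" "g \<in> Mor ?C" "source f = target g" for f g
    using that composable(3)[of "source g" "target g" "label g" "target f" "label f"]
    by (metis arrow.collapse poset_cat_sel(4))
  have join: "is_join (label f) (label g) (join (label f) (label g))"
    if "f \<in> Mor ?C" "g \<in> Mor ?C" "source f = target g" for f g
    using that composable(1)[of "source g" "target g" "label g" "target f" "label f"]
    by (metis arrow.collapse)
  have assoc: "Comp ?C (Comp ?C f g) h = Comp ?C f (Comp ?C g h)"
    if "f \<in> Mor ?C" "g \<in> Mor ?C" "h \<in> Mor ?C" "source f = target g" "source g = target h"
    for f g h
  proof -
    let ?fg = "join (label f) (label g)" and ?gh = "join (label g) (label h)"
    \<comment> \<open>The composite of \<open>f\<close> and \<open>g\<close> is itself a morphism
      composable with \<open>h\<close>, so its label has a join with that of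
      \<open>h\<close>.\<close>
    have "is_join ?fg (label h) (join ?fg (label h))"
      using join[of "Comp ?C f g" h] comp[of f g] that by simp
    then have "is_join (label f) ?gh (join ?fg (label h))"
      using is_join_assoc[OF join[of f g] join[of g h]] that by simp
    then show ?thesis
      by (simp add: join_eqI)
  qed
  have bot: "is_join x bot x" "is_join bot x x" for x :: 'a
    by (simp_all add: is_join_def)
  have "\<exists>e\<in>Mor ?C. source e = x \<and> target e = x \<and>
      (\<forall>f\<in>Mor ?C. source f = x \<longrightarrow> Comp ?C f e = f) \<and>
      (\<forall>g\<in>Mor ?C. target g = x \<longrightarrow> Comp ?C e g = g)" for x
  \<comment> \<open>The identity is labelled \<open>bot\<close>, which is neutral for joins and has
    rank 0.\<close>
  proof (rule bexI[of _ "Arrow x x bot"])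
    show "Arrow x x bot \<in> Mor ?C"
      by (simp add: Arrow_mem_Mor_iff bot rank_bot)
  qed (auto simp: join_eqI[OF bot(1)] join_eqI[OF bot(2)])
  then show ?thesis
    unfolding small_category_def using comp assoc by simp
qed

lemma schemoid_poset_cat: "schemoid (poset_cat \<rho>) (UNIV :: 'a set) label"
proof -
  have "factorizations (poset_cat \<rho>) label i j h \<approx> factorizations (poset_cat \<rho>) label i j k"
    if "h \<in> Mor (poset_cat \<rho>)" "k \<in> Mor (poset_cat \<rho>)" "label h = label k" for h k i j
    \<comment> \<open>Equal labels give the same condition on \<open>i\<close> and \<open>j\<close>,
      so both sets are empty or both are singletons.\<close>
    using that by (cases h; cases k) (simp add: factorizations_Arrow singleton_eqpoll)
  then show ?thesis
    by (simp add: schemoid_def small_category_poset_cat)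
qed

end

theorem theorem3p8:
  fixes \<rho> :: "'a::order_bot \<Rightarrow> nat"
  assumes "\<And>x y :: 'a. \<exists>\<^sub>\<le>\<^sub>1 z. z \<in> minimal_upper_bounds x y"
    and "rank_function \<rho>"
    and "\<And>x y :: 'a. has_join x y \<Longrightarrow> \<rho> (join x y) \<le> \<rho> x + \<rho> y"
  shows "schemoid (poset_cat \<rho>) (UNIV :: 'a set) label"
proof -
  interpret subadditive_rank \<rho>
    using assms by unfold_locales
  show ?thesis
    by (rule schemoid_poset_cat)
qed

end
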